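(* The following assertion (a conjecture from the literature) is false: "For every integer $d\ge 2$, the minimal value of the $Q$-volume $V_Q(\mathcal B)$ over all $d$-quasi-copulas $Q$ and all $d$-boxes $\mathcal B\subseteq[0,1]^d$ equals $-\frac{(d-1)^2}{2d-1}$, and it is attained for some $d$-quasi-copula $Q$ on the box $\mathcal B=\left[\frac{d-1}{2d-1},\frac{2d-2}{2d-1}\right]^d$."
   Context: Let $d\ge 2$. A $d$-quasi-copula is a function $Q:[0,1]^d\to[0,1]$ such that: (BC) $Q(u_1,\ldots,u_d)=0$ whenever some $u_i=0$, and $Q(1,\ldots,1,u_i,1,\ldots,1)=u_i$ for every $i$ and every $u_i\in[0,1]$; (MC) $Q$ is nondecreasing in each variable; (LC) $|Q(u_1,\ldots,u_d)-Q(v_1,\ldots,v_d)|\le\sum_{i=1}^d|u_i-v_i|$ for all points of $[0,1]^d$. A $d$-box is $\mathcal B=\prod_{i=1}^d[a_i,b_i]\subseteq[0,1]^d$ with $a_i<b_i$ for each $i$. For $\mathbb I\in\{0,1\}^d$ let $x_{\mathbb I}$ be the vertex of $\mathcal B$ whose $k$-th coordinate is $a_k$ if $\mathbb I_k=0$ and $b_k$ if $\mathbb I_k=1$. The $Q$-volume of $\mathcal B$ is $V_Q(\mathcal B)=\sum_{\mathbb I\in\{0,1\}^d}(-1)^{d-\|\mathbb I\|_1}Q(x_{\mathbb I})$, where $\|\mathbb I\|_1=\sum_{j=1}^d\mathbb I_j$. *)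

theory Defs
  imports Complex_Main "HOL-Library.FuncSet"
begin

text \<open>
  The dimension \<open>d\<close> is a natural number, and coordinates are indexed by \<open>{..<d}\<close>. A point of
  the unit cube is a function that is \<open>undefined\<close> off \<open>{..<d}\<close>, so points correspond one-to-one
  to elements of \<open>[0,1]\<^sup>d\<close>. The values of a map outside the cube are irrelevant.
\<close>

definition unit_cube :: "nat \<Rightarrow> (nat \<Rightarrow> real) set" where
  "unit_cube d = ({..<d} \<rightarrow>\<^sub>E {0..1})"

definition boundary_cond :: "nat \<Rightarrow> ((nat \<Rightarrow> real) \<Rightarrow> real) \<Rightarrow> bool" where
  "boundary_cond d Q \<longleftrightarrow>
     (\<forall>u\<in>unit_cube d. (\<exists>i<d. u i = 0) \<longrightarrow> Q u = 0) \<and>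
     (\<forall>i<d. \<forall>t\<in>{0..1}. Q (\<lambda>k\<in>{..<d}. if k = i then t else 1) = t)"

definition monotone_cond :: "nat \<Rightarrow> ((nat \<Rightarrow> real) \<Rightarrow> real) \<Rightarrow> bool" where
  "monotone_cond d Q \<longleftrightarrow>
     (\<forall>u\<in>unit_cube d. \<forall>i<d. \<forall>t\<in>{u i..1}. Q u \<le> Q (u(i := t)))"

definition lipschitz_cond :: "nat \<Rightarrow> ((nat \<Rightarrow> real) \<Rightarrow> real) \<Rightarrow> bool" where
  "lipschitz_cond d Q \<longleftrightarrow>
     (\<forall>u\<in>unit_cube d. \<forall>v\<in>unit_cube d. \<bar>Q u - Q v\<bar> \<le> (\<Sum>i<d. \<bar>u i - v i\<bar>))"

definition quasi_copula :: "nat \<Rightarrow> ((nat \<Rightarrow> real) \<Rightarrow> real) \<Rightarrow> bool" where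
  "quasi_copula d Q \<longleftrightarrow>
     Q \<in> unit_cube d \<rightarrow> {0..1} \<and> boundary_cond d Q \<and> monotone_cond d Q \<and> lipschitz_cond d Q"

text \<open>
  A box is given by its lower and upper corners \<open>a\<close> and \<open>b\<close>, of which only the coordinates
  below \<open>d\<close> are used.
\<close>

definition is_box :: "nat \<Rightarrow> (nat \<Rightarrow> real) \<Rightarrow> (nat \<Rightarrow> real) \<Rightarrow> bool" where
  "is_box d a b \<longleftrightarrow> (\<forall>i<d. 0 \<le> a i \<and> a i < b i \<and> b i \<le> 1)"

definition box_vertex :: "nat \<Rightarrow> (nat \<Rightarrow> real) \<Rightarrow> (nat \<Rightarrow> real) \<Rightarrow> (nat \<Rightarrow> nat) \<Rightarrow> (nat \<Rightarrow> real)" where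
  "box_vertex d a b I = (\<lambda>k\<in>{..<d}. if I k = 0 then a k else b k)"

definition Q_volume :: "nat \<Rightarrow> ((nat \<Rightarrow> real) \<Rightarrow> real) \<Rightarrow> (nat \<Rightarrow> real) \<Rightarrow> (nat \<Rightarrow> real) \<Rightarrow> real" where
  "Q_volume d Q a b =
     (\<Sum>I \<in> {..<d} \<rightarrow>\<^sub>E {0, 1}. (- 1) ^ (d - (\<Sum>j<d. I j)) * Q (box_vertex d a b I))"

definition Q_volumes :: "nat \<Rightarrow> real set" where
  "Q_volumes d = {Q_volume d Q a b | Q a b. quasi_copula d Q \<and> is_box d a b}"

definition is_minimum :: "real set \<Rightarrow> real \<Rightarrow> bool" where
  "is_minimum S m \<longleftrightarrow> m \<in> S \<and> (\<forall>x\<in>S. m \<le> x)"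

end

(* For a monotone 1-Lipschitz function \<phi> of the coordinate sum, clamping \<phi> between the
   Frechet-Hoeffding bounds W and M gives a quasi-copula. Its volume on a box [a,b]^d is the
   alternating binomial sum of the values q k at the vertices having k coordinates equal to b.
   For d = 5 and [a,b] = [8/13, 12/13] one can choose \<phi> so that q = 0, 0, s, s, 2s, 2s with
   s = b - a = 4/13. The volume is then -8s = -32/13, below the conjectured -16/9. *)

theory Submission
  imports Defs
begin

text \<open>The outer \<open>max\<close> is with the lower Frechet-Hoeffding bound W, the inner
  \<open>min\<close> with the upper bound M, the least coordinate.\<close>

definition clamped_sum :: "nat \<Rightarrow> (real \<Rightarrow> real) \<Rightarrow> (nat \<Rightarrow> real) \<Rightarrow> real" where
  "clamped_sum d \<phi> u =
     max (max 0 ((\<Sum>i<d. u i) - real d + 1)) (min (Min (u ` {..<d})) (\<phi> (\<Sum>i<d. u i)))"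

text \<open>The other d - 1 coordinates are at most 1 each. Thus W \<le> M on the cube, so the outer
  \<open>max\<close> never pushes the clamped value above M.\<close>

lemma lower_bound_le_coordinate:
  assumes "u \<in> unit_cube d" "i < d"
  shows "max 0 ((\<Sum>k<d. u k) - real d + 1) \<le> u i"
proof -
  have u: "0 \<le> u k" "u k \<le> 1" if "k < d" for k
    using assms(1) that by (auto simp: unit_cube_def PiE_iff)
  have "(\<Sum>k<d. u k) = u i + (\<Sum>k\<in>{..<d} - {i}. u k)"
    using assms(2) by (simp add: sum.remove)
  also have "(\<Sum>k\<in>{..<d} - {i}. u k) \<le> (\<Sum>k\<in>{..<d} - {i}. 1)"
    by (rule sum_mono) (use u in auto)
  also have "\<dots> = real d - 1"
    using assms(2) by (simp add: of_nat_diff)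
  finally show ?thesis
    using u[OF assms(2)] by simp
qed

lemma clamped_sum_le_coordinate:
  assumes "u \<in> unit_cube d" "i < d"
  shows "clamped_sum d \<phi> u \<le> u i"
proof -
  have "Min (u ` {..<d}) \<le> u i"
    using assms(2) by (intro Min_le) auto
  with lower_bound_le_coordinate[OF assms] show ?thesis
    unfolding clamped_sum_def by linarith
qed

lemma Min_image_mono:
  fixes u v :: "'a \<Rightarrow> real"
  assumes "finite A" "A \<noteq> {}" "\<And>i. i \<in> A \<Longrightarrow> u i \<le> v i + c"
  shows "Min (u ` A) \<le> Min (v ` A) + c"
proof -
  have "Min (v ` A) \<in> v ` A"
    using assms by (intro Min_in) auto
  then obtain i where i: "i \<in> A" "Min (v ` A) = v i"
    by auto
  have "Min (u ` A) \<le> u i"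
    using assms(1) i(1) by (intro Min_le) auto
  with assms(3)[OF i(1)] i(2) show ?thesis
    by linarith
qed

text \<open>Each ingredient of the clamp grows by at most c, and \<open>max\<close> and
  \<open>min\<close> preserve such a bound; the constant 0 is where c \<ge> 0 enters. The case c = 0
  yields monotonicity, and c equal to the l1-distance yields the Lipschitz condition.\<close>

lemma clamped_sum_le:
  assumes "0 < d" "0 \<le> c"
    and "\<And>i. i < d \<Longrightarrow> u i \<le> v i + c"
    and "(\<Sum>i<d. u i) \<le> (\<Sum>i<d. v i) + c"
    and "\<phi> (\<Sum>i<d. u i) \<le> \<phi> (\<Sum>i<d. v i) + c"
  shows "clamped_sum d \<phi> u \<le> clamped_sum d \<phi> v + c"
proof -
  have "Min (u ` {..<d}) \<le> Min (v ` {..<d}) + c"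
    by (rule Min_image_mono) (use assms(1,3) in auto)
  then show ?thesis
    using assms(2,4,5) unfolding clamped_sum_def by linarith
qed

lemma clamped_sum_lipschitz:
  assumes "0 < d" "\<And>s t. s \<le> t \<Longrightarrow> \<phi> s \<le> \<phi> t" "\<And>s t. s \<le> t \<Longrightarrow> \<phi> t - \<phi> s \<le> t - s"
  shows "clamped_sum d \<phi> u \<le> clamped_sum d \<phi> v + (\<Sum>i<d. \<bar>u i - v i\<bar>)"
proof (rule clamped_sum_le)
  let ?D = "\<Sum>i<d. \<bar>u i - v i\<bar>"
  show "0 < d" "0 \<le> ?D"
    using assms(1) by (auto intro: sum_nonneg)
  show "u i \<le> v i + ?D" if "i < d" for i
    using member_le_sum[of i "{..<d}" "\<lambda>i. \<bar>u i - v i\<bar>"] that by simp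
  show sum_le: "(\<Sum>i<d. u i) \<le> (\<Sum>i<d. v i) + ?D"
    unfolding sum.distrib[symmetric] by (rule sum_mono) simp
  \<comment> \<open>If the sum of u is the smaller one, monotonicity of \<phi> suffices; otherwise
    \<phi> grows by at most the difference of the sums, which is at most \<open>?D\<close>.\<close>
  show "\<phi> (\<Sum>i<d. u i) \<le> \<phi> (\<Sum>i<d. v i) + ?D"
    using assms(2,3)[of "\<Sum>i<d. u i" "\<Sum>i<d. v i"] assms(3)[of "\<Sum>i<d. v i" "\<Sum>i<d. u i"]
      sum_le \<open>0 \<le> ?D\<close> by linarith
qed

text \<open>The boundary condition comes from the clamping: W and M coincide wherever a coordinate
  is 0 or all but one are 1. The assumptions on \<phi> give (MC) and (LC).\<close>

lemma quasi_copula_clamped_sum: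
  assumes d: "0 < d" and mono: "\<And>s t. s \<le> t \<Longrightarrow> \<phi> s \<le> \<phi> t"
    and lip: "\<And>s t. s \<le> t \<Longrightarrow> \<phi> t - \<phi> s \<le> t - s"
  shows "quasi_copula d (clamped_sum d \<phi>)"
proof -
  let ?Q = "clamped_sum d \<phi>"
  have ge: "0 \<le> ?Q u" "(\<Sum>i<d. u i) - real d + 1 \<le> ?Q u" for u
    by (auto simp: clamped_sum_def)
  have "?Q u \<le> 1" if "u \<in> unit_cube d" for u
    using clamped_sum_le_coordinate[OF that d, of \<phi>] that d
    by (force simp: unit_cube_def PiE_iff)
  then have range: "?Q \<in> unit_cube d \<rightarrow> {0..1}"
    using ge by auto
  have zero: "?Q u = 0" if "u \<in> unit_cube d" "i < d" "u i = 0" for u i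
    using clamped_sum_le_coordinate[OF that(1,2), of \<phi>] ge(1)[of u] that(3) by simp
  have margin: "?Q (\<lambda>k\<in>{..<d}. if k = i then t else 1) = t"
    if i: "i < d" and t: "t \<in> {0..1}" for i t
  proof -
    let ?u = "\<lambda>k\<in>{..<d}. if k = i then t else (1::real)"
    have cube: "?u \<in> unit_cube d"
      using t by (auto simp: unit_cube_def)
    have "(\<Sum>k<d. ?u k) = ?u i + (\<Sum>k\<in>{..<d} - {i}. ?u k)"
      using i by (simp add: sum.remove)
    also have "(\<Sum>k\<in>{..<d} - {i}. ?u k) = (\<Sum>k\<in>{..<d} - {i}. 1)"
      by (rule sum.cong) auto
    also have "\<dots> = real d - 1"
      using i by (simp add: of_nat_diff)
    finally have "t \<le> ?Q ?u"
      using ge(2)[of ?u] i by simp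
    moreover have "?Q ?u \<le> t"
      using clamped_sum_le_coordinate[OF cube i, of \<phi>] i by simp
    ultimately show ?thesis
      by simp
  qed
  have increasing: "?Q u \<le> ?Q (u(i := t))" if "u i \<le> t" for u i t
  proof -
    have "(\<Sum>k<d. u k) \<le> (\<Sum>k<d. (u(i := t)) k)"
      by (rule sum_mono) (use that in auto)
    then show ?thesis
      using clamped_sum_le[of d 0 u "u(i := t)" \<phi>] d mono that by simp
  qed
  have lipschitz: "\<bar>?Q u - ?Q v\<bar> \<le> (\<Sum>i<d. \<bar>u i - v i\<bar>)" for u v
  proof -
    have "(\<Sum>i<d. \<bar>v i - u i\<bar>) = (\<Sum>i<d. \<bar>u i - v i\<bar>)"
      by (simp add: abs_minus_commute)
    then show ?thesis
      using clamped_sum_lipschitz[where u = u and v = v and \<phi> = \<phi>, OF d mono lip]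
        clamped_sum_lipschitz[where u = v and v = u and \<phi> = \<phi>, OF d mono lip]
      by (simp add: abs_le_iff)
  qed
  show ?thesis
    unfolding quasi_copula_def boundary_cond_def monotone_cond_def lipschitz_cond_def
    using range zero margin increasing lipschitz by auto
qed

text \<open>The vertices are split by the value, 0 or 1, of the last coordinate n.\<close>

lemma sum_binary_PiE_Suc:
  fixes f :: "nat \<Rightarrow> 'a::comm_monoid_add"
  shows "(\<Sum>I \<in> {..<Suc n} \<rightarrow>\<^sub>E {0, 1}. f (\<Sum>j<Suc n. I j)) =
    (\<Sum>I \<in> {..<n} \<rightarrow>\<^sub>E {0, 1}. f (\<Sum>j<n. I j)) + (\<Sum>I \<in> {..<n} \<rightarrow>\<^sub>E {0, 1}. f (Suc (\<Sum>j<n. I j)))"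
proof -
  let ?P = "{..<n} \<rightarrow>\<^sub>E {0, 1::nat}"
  let ?h = "\<lambda>(y::nat, g). g(n := y)"
  have inj: "inj_on ?h ({0, 1} \<times> ?P)"
    using inj_combinator[of n "{..<n}" "\<lambda>_. {0, 1::nat}"] by simp
  have "(\<Sum>I \<in> {..<Suc n} \<rightarrow>\<^sub>E {0, 1}. f (\<Sum>j<Suc n. I j)) =
      (\<Sum>p \<in> {0, 1} \<times> ?P. f (\<Sum>j<Suc n. ?h p j))"
    unfolding lessThan_Suc PiE_insert_eq by (subst sum.reindex[OF inj]) simp
  also have "\<dots> = (\<Sum>(y, g) \<in> {0, 1} \<times> ?P. f ((\<Sum>j<n. g j) + y))"
  proof (rule sum.cong[OF refl])
    have "(\<Sum>j<Suc n. (g(n := y)) j) = (\<Sum>j<n. g j) + y" for g :: "nat \<Rightarrow> nat" and y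
      unfolding sum.lessThan_Suc by (intro arg_cong2[where f = "(+)"] sum.cong) auto
    then show "f (\<Sum>j<Suc n. ?h p j) = (case p of (y, g) \<Rightarrow> f ((\<Sum>j<n. g j) + y))" for p
      by (simp only: case_prod_unfold)
  qed
  also have "\<dots> = (\<Sum>y \<in> {0, 1}. \<Sum>g \<in> ?P. f ((\<Sum>j<n. g j) + y))"
    by (rule sum.cartesian_product[symmetric])
  also have "\<dots> = (\<Sum>g \<in> ?P. f (\<Sum>j<n. g j)) + (\<Sum>g \<in> ?P. f (Suc (\<Sum>j<n. g j)))"
    by simp
  finally show ?thesis .
qed

text \<open>Induction on n by Pascal's rule; f is generalized because the half with last coordinate
  1 sees f shifted by one.\<close>

lemma sum_binary_PiE_eq_binomial_sum:
  fixes f :: "nat \<Rightarrow> 'a::comm_semiring_1"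
  shows "(\<Sum>I \<in> {..<n} \<rightarrow>\<^sub>E {0, 1}. f (\<Sum>j<n. I j)) = (\<Sum>k\<le>n. of_nat (n choose k) * f k)"
proof (induction n arbitrary: f)
  case 0
  then show ?case
    by simp
next
  case (Suc n)
  \<comment> \<open>The added term is zero since \<open>n choose Suc n = 0\<close>; it lets the
    index shift match the range of the other sum.\<close>
  have "(\<Sum>k\<le>n. of_nat (n choose k) * f k) = (\<Sum>k\<le>Suc n. of_nat (n choose k) * f k)"
    by (simp add: binomial_eq_0)
  also have "\<dots> = f 0 + (\<Sum>k\<le>n. of_nat (n choose Suc k) * f (Suc k))"
    unfolding sum.atMost_Suc_shift by simp
  finally have "(\<Sum>I \<in> {..<Suc n} \<rightarrow>\<^sub>E {0, 1}. f (\<Sum>j<Suc n. I j)) =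
      f 0 + (\<Sum>k\<le>n. of_nat (n choose Suc k) * f (Suc k)) + (\<Sum>k\<le>n. of_nat (n choose k) * f (Suc k))"
    using sum_binary_PiE_Suc[of f n] Suc.IH[of f] Suc.IH[of "\<lambda>k. f (Suc k)"] by simp
  also have "\<dots> = (\<Sum>k\<le>Suc n. of_nat (Suc n choose k) * f k)"
    unfolding sum.atMost_Suc_shift by (simp add: sum.distrib distrib_right add_ac)
  finally show ?case .
qed

theorem mainTheorem1:
  "\<not> (\<forall>d::nat. d \<ge> 2 \<longrightarrow>
        is_minimum (Q_volumes d) (- ((real d - 1)\<^sup>2 / (2 * real d - 1))) \<and>
        (\<exists>Q. quasi_copula d Q \<and>
             Q_volume d Q (\<lambda>_. (real d - 1) / (2 * real d - 1))
                          (\<lambda>_. (2 * real d - 2) / (2 * real d - 1))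
               = - ((real d - 1)\<^sup>2 / (2 * real d - 1))))"
proof
  assume conjecture: "\<forall>d::nat. d \<ge> 2 \<longrightarrow>
        is_minimum (Q_volumes d) (- ((real d - 1)\<^sup>2 / (2 * real d - 1))) \<and>
        (\<exists>Q. quasi_copula d Q \<and>
             Q_volume d Q (\<lambda>_. (real d - 1) / (2 * real d - 1))
                          (\<lambda>_. (2 * real d - 2) / (2 * real d - 1))
               = - ((real d - 1)\<^sup>2 / (2 * real d - 1)))"
  (* Slope 1 on [44/13, 48/13] and on [52/13, 56/13], constant elsewhere. *)
  define \<phi> :: "real \<Rightarrow> real" where
    "\<phi> s = max 0 (max (min (4/13) (s - 44/13)) (min (8/13) (s - 48/13)))" for s
  \<comment> \<open>The value 2s at k = 4 requires 2s \<le> a (bound M), and at k = 5 it requires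
    5(a + s) - 4 \<le> 2s (bound W). Hence 13s \<le> 4, and equality forces s = 4/13, a = 8/13, b =
    12/13.\<close>
  let ?Q = "clamped_sum 5 \<phi>" and ?a = "\<lambda>_::nat. 8/13 :: real" and ?b = "\<lambda>_::nat. 12/13 :: real"
  have Q: "quasi_copula 5 ?Q"
  proof (rule quasi_copula_clamped_sum)
    fix s t :: real
    assume st: "s \<le> t"
    then show "\<phi> s \<le> \<phi> t"
      by (auto simp: \<phi>_def)
    \<comment> \<open>The slope bound is checked separately for each piece of the maximum defining
      \<phi>.\<close>
    have shift: "min c (t - e) \<le> min c (s - e) + (t - s)" for c e :: real
      using st by linarith
    have "0 \<le> \<phi> s" "min (4/13) (s - 44/13) \<le> \<phi> s" "min (8/13) (s - 48/13) \<le> \<phi> s"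
      unfolding \<phi>_def by (simp_all only: le_max_iff_disj order_refl simp_thms)
    then have "0 \<le> \<phi> s + (t - s)" "min (4/13) (t - 44/13) \<le> \<phi> s + (t - s)"
      "min (8/13) (t - 48/13) \<le> \<phi> s + (t - s)"
      using st by (auto intro: order_trans[OF shift] add_right_mono simp del: min.bounded_iff)
    then have "\<phi> t \<le> \<phi> s + (t - s)"
      unfolding \<phi>_def[of t] by (intro max.boundedI)
    then show "\<phi> t - \<phi> s \<le> t - s"
      by simp
  qed simp
  \<comment> \<open>At a vertex with k upper coordinates the sum is (40 + 4k)/13, so W is the
    positive part of (4k - 12)/13. M is absent because all coordinates are at least 8/13, the
    largest value of \<phi>.\<close>
  define q where "q k = max (max 0 (4 * real k / 13 - 12/13)) (\<phi> (40/13 + 4 * real k / 13))"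
    for k :: nat
  have vertex: "?Q (box_vertex 5 ?a ?b I) = q (\<Sum>j<5. I j)"
    if I: "I \<in> {..<5} \<rightarrow>\<^sub>E {0, 1}" for I
  proof -
    let ?x = "box_vertex 5 ?a ?b I"
    have "?x k = 8/13 + 4 * real (I k) / 13" if "k < 5" for k
      using PiE_mem[OF I, of k] that by (auto simp: box_vertex_def)
    then have "(\<Sum>k<5. ?x k) = (\<Sum>k<5. 8/13 + 4 * real (I k) / 13)"
      by simp
    also have "\<dots> = 40/13 + 4 * real (\<Sum>j<5. I j) / 13"
      by (simp add: sum.distrib sum_divide_distrib sum_distrib_left)
    finally have sum_x: "(\<Sum>k<5. ?x k) = 40/13 + 4 * real (\<Sum>j<5. I j) / 13" .
    have "8/13 \<le> Min (?x ` {..<5})"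
    proof (rule Min.boundedI)
      show "?x ` {..<5} \<noteq> {}"
        by (simp add: lessThan_empty_iff)
    qed (auto simp: box_vertex_def)
    moreover have "\<phi> s \<le> 8/13" for s
      unfolding \<phi>_def by (simp only: max.bounded_iff min_le_iff_disj) simp
    ultimately have "min (Min (?x ` {..<5})) (\<phi> s) = \<phi> s" for s
      by (intro min_absorb2) (rule order_trans)
    then show ?thesis
      unfolding clamped_sum_def q_def sum_x by simp
  qed
  have "Q_volume 5 ?Q ?a ?b =
      (\<Sum>I \<in> {..<5::nat} \<rightarrow>\<^sub>E {0, 1}. (\<lambda>k. (- 1) ^ (5 - k) * q k) (\<Sum>j<5. I j))"
    unfolding Q_volume_def by (intro sum.cong) (simp_all add: vertex)
  also have "\<dots> = (\<Sum>k\<le>5. real (5 choose k) * ((- 1) ^ (5 - k) * q k))"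
    by (rule sum_binary_PiE_eq_binomial_sum)
  also have "\<dots> = - q 0 + 5 * q 1 - 10 * q 2 + 10 * q 3 - 5 * q 4 + q 5"
    by (simp add: numeral_eq_Suc)
  \<comment> \<open>The terms for k = 2 and k = 3 cancel; k = 4 and k = 5 leave -10s + 2s.\<close>
  also have "\<dots> = - 32/13"
    by (simp add: q_def \<phi>_def)
  finally have volume: "Q_volume 5 ?Q ?a ?b = - 32/13" .
  have box: "is_box 5 ?a ?b"
    by (simp add: is_box_def)
  have "- 32/13 \<in> Q_volumes 5"
    unfolding Q_volumes_def by (intro CollectI exI conjI) (rule volume[symmetric] Q box)+
  \<comment> \<open>The contradiction is with the minimality claim at d = 5.\<close>
  moreover have "is_minimum (Q_volumes 5) (- ((real 5 - 1)\<^sup>2 / (2 * real 5 - 1)))"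
    using conjecture[rule_format, of 5] by simp
  ultimately have "- ((real 5 - 1)\<^sup>2 / (2 * real 5 - 1)) \<le> (- 32/13 :: real)"
    unfolding is_minimum_def by blast
  then show False
    by simp
qed

end
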